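(* Let $A$ be a $C^*$-algebra, $X$ a Hilbert $A$-module, $\mathcal{H}$ a Hilbert space and $\varphi:A\to L(\mathcal{H})$ a completely positive linear map. If $\mathcal{K}_1,\mathcal{K}_2$ are Hilbert spaces and $\Phi_1:X\to L(\mathcal{H},\mathcal{K}_1)$ and $\Phi_2:X\to L(\mathcal{H},\mathcal{K}_2)$ are two $\varphi$-maps, then $X_{\Phi_1}=X_{\Phi_2}$.
   Context: Hilbert $C^*$-modules are right modules, with inner product linear in the second variable. $L(\mathcal{H},\mathcal{K})$ denotes the bounded linear operators from $\mathcal{H}$ to $\mathcal{K}$, and $L(\mathcal{H})=L(\mathcal{H},\mathcal{H})$. A map $\Phi:X\to L(\mathcal{H},\mathcal{K})$ is a $\varphi$-map if $\Phi(x)^*\Phi(y)=\varphi(\langle x,y\rangle)$ for all $x,y\in X$. Its $\varphi$-module domain is $X_\Phi=\{x\in X:\Phi(xb)=\Phi(x)\varphi(b)\text{ for all }b\in A\}$. *)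

theory Defs
  imports "HOL-Analysis.Analysis"
begin

section \<open>Complex normed spaces, Hilbert spaces and C*-algebras\<close>

class complex_normed_vector = real_normed_vector +
  fixes scaleC :: "complex \<Rightarrow> 'a \<Rightarrow> 'a" (infixr \<open>*\<^sub>C\<close> 75)
  assumes scaleC_add_right: "c *\<^sub>C (x + y) = c *\<^sub>C x + c *\<^sub>C y"
    and scaleC_add_left: "(c + d) *\<^sub>C x = c *\<^sub>C x + d *\<^sub>C x"
    and scaleC_scaleC: "c *\<^sub>C d *\<^sub>C x = (c * d) *\<^sub>C x"
    and scaleC_one: "1 *\<^sub>C x = x"
    and scaleR_scaleC: "r *\<^sub>R x = complex_of_real r *\<^sub>C x"
    and norm_scaleC: "norm (c *\<^sub>C x) = cmod c * norm x"

text \<open>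
  The axiom \<open>cinner_self\<close> says that the form is positive definite and that
  the norm is the one it induces.
\<close>

class chilbert_space = complex_normed_vector + banach +
  fixes cinner :: "'a \<Rightarrow> 'a \<Rightarrow> complex"
  assumes cinner_commute: "cinner x y = cnj (cinner y x)"
    and cinner_add_right: "cinner x (y + z) = cinner x y + cinner x z"
    and cinner_scaleC_right: "cinner x (c *\<^sub>C y) = c * cinner x y"
    and cinner_self: "cinner x x = complex_of_real ((norm x)\<^sup>2)"

text \<open>C*-algebras are not required to have a unit.\<close>

class cstar_algebra = complex_normed_vector + real_normed_algebra + banach +
  fixes star :: "'a \<Rightarrow> 'a"
  assumes mult_scaleC_left: "(c *\<^sub>C a) * b = c *\<^sub>C (a * b)"
    and mult_scaleC_right: "a * (c *\<^sub>C b) = c *\<^sub>C (a * b)"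
    and star_add: "star (a + b) = star a + star b"
    and star_scaleC: "star (c *\<^sub>C a) = cnj c *\<^sub>C star a"
    and star_mult: "star (a * b) = star b * star a"
    and star_star: "star (star a) = a"
    and cstar_identity: "norm (star a * a) = (norm a)\<^sup>2"

definition positive_element :: "'a::cstar_algebra \<Rightarrow> bool" where
  "positive_element a \<longleftrightarrow> (\<exists>b. a = star b * b)"

section \<open>Hilbert modules\<close>

text \<open>
  The norm of the type \<open>'x\<close> is required to be the module norm, so that
  the class \<open>banach\<close> expresses completeness with respect to the latter.
\<close>

locale hilbert_module =
  fixes act :: "'x::{complex_normed_vector, banach} \<Rightarrow> 'a::cstar_algebra \<Rightarrow> 'x"
    and ip :: "'x \<Rightarrow> 'x \<Rightarrow> 'a"
  assumes act_add_left: "act (x + y) a = act x a + act y a"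
    and act_add_right: "act x (a + b) = act x a + act x b"
    and act_mult: "act x (a * b) = act (act x a) b"
    and act_scaleC_left: "act (c *\<^sub>C x) a = c *\<^sub>C act x a"
    and act_scaleC_right: "act x (c *\<^sub>C a) = c *\<^sub>C act x a"
    and ip_add_right: "ip x (y + z) = ip x y + ip x z"
    and ip_scaleC_right: "ip x (c *\<^sub>C y) = c *\<^sub>C ip x y"
    and ip_act_right: "ip x (act y a) = ip x y * a"
    and ip_star: "star (ip x y) = ip y x"
    and ip_positive: "positive_element (ip x x)"
    and ip_definite: "ip x x = 0 \<Longrightarrow> x = 0"
    and norm_ip: "norm x = sqrt (norm (ip x x))"

section \<open>Operators and completely positive maps\<close>

text \<open>
  The type \<open>'h \<Rightarrow>\<^sub>L 'k\<close> contains all bounded real-linear maps;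
  \<open>L(H,K)\<close> is the set of the complex-linear ones.
\<close>

definition bounded_operators ::
    "('h::complex_normed_vector \<Rightarrow>\<^sub>L 'k::complex_normed_vector) set" where
  "bounded_operators = {T. \<forall>c x. blinfun_apply T (c *\<^sub>C x) = c *\<^sub>C blinfun_apply T x}"

definition adjoint_operator ::
    "('h::chilbert_space \<Rightarrow>\<^sub>L 'k::chilbert_space) \<Rightarrow> ('k \<Rightarrow>\<^sub>L 'h)" where
  "adjoint_operator T = (THE S. S \<in> bounded_operators \<and>
     (\<forall>x y. cinner (blinfun_apply S y) x = cinner y (blinfun_apply T x)))"

text \<open>
  An \<open>n \<times> n\<close> matrix is a function of two indices, of which only the values
  at indices below \<open>n\<close> matter. Positivity in the C*-algebra \<open>M\<^sub>n(A)\<close> again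
  means being of the form \<open>B\<^sup>*B\<close>; the \<open>(i, k)\<close> entry of \<open>B\<^sup>*\<close> is \<open>star (B k i)\<close>.
\<close>

definition positive_matrix :: "nat \<Rightarrow> (nat \<Rightarrow> nat \<Rightarrow> 'a::cstar_algebra) \<Rightarrow> bool" where
  "positive_matrix n M \<longleftrightarrow>
     (\<exists>B. \<forall>i<n. \<forall>j<n. M i j = (\<Sum>k<n. star (B k i) * B k j))"

text \<open>
  A matrix over \<open>L(H)\<close> acts on the direct sum \<open>H\<^sup>n\<close>, with inner product the
  sum of the componentwise ones, and is positive if \<open>\<langle>h, T h\<rangle> \<ge> 0\<close> for all
  \<open>h \<in> H\<^sup>n\<close>.
\<close>

definition positive_operator_matrix ::
    "nat \<Rightarrow> (nat \<Rightarrow> nat \<Rightarrow> 'h::chilbert_space \<Rightarrow>\<^sub>L 'h) \<Rightarrow> bool" where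
  "positive_operator_matrix n T \<longleftrightarrow>
     (\<forall>h. (\<Sum>i<n. cinner (h i) (\<Sum>j<n. blinfun_apply (T i j) (h j))) \<in> \<real>\<^sub>\<ge>\<^sub>0)"

definition completely_positive_linear ::
    "('a::cstar_algebra \<Rightarrow> 'h::chilbert_space \<Rightarrow>\<^sub>L 'h) \<Rightarrow> bool" where
  "completely_positive_linear \<phi> \<longleftrightarrow>
     (\<forall>a. \<phi> a \<in> bounded_operators) \<and>
     (\<forall>a b. \<phi> (a + b) = \<phi> a + \<phi> b) \<and>
     (\<forall>c a h. blinfun_apply (\<phi> (c *\<^sub>C a)) h = c *\<^sub>C blinfun_apply (\<phi> a) h) \<and>
     (\<forall>n M. positive_matrix n M \<longrightarrow> positive_operator_matrix n (\<lambda>i j. \<phi> (M i j)))"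

section \<open>\<open>\<phi>\<close>-maps\<close>

definition phi_map ::
    "('x \<Rightarrow> 'x \<Rightarrow> 'a) \<Rightarrow> ('a \<Rightarrow> 'h::chilbert_space \<Rightarrow>\<^sub>L 'h)
      \<Rightarrow> ('x \<Rightarrow> 'h \<Rightarrow>\<^sub>L 'k::chilbert_space) \<Rightarrow> bool" where
  "phi_map ip \<phi> \<Phi> \<longleftrightarrow>
     (\<forall>x. \<Phi> x \<in> bounded_operators) \<and>
     (\<forall>x y. adjoint_operator (\<Phi> x) o\<^sub>L \<Phi> y = \<phi> (ip x y))"

definition module_domain ::
    "('x \<Rightarrow> 'a \<Rightarrow> 'x) \<Rightarrow> ('a \<Rightarrow> 'h::chilbert_space \<Rightarrow>\<^sub>L 'h)
      \<Rightarrow> ('x \<Rightarrow> 'h \<Rightarrow>\<^sub>L 'k::chilbert_space) \<Rightarrow> 'x set" where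
  "module_domain act \<phi> \<Phi> = {x. \<forall>b. \<Phi> (act x b) = \<Phi> x o\<^sub>L \<phi> b}"

end

theory Submission
  imports Defs
begin

text \<open>
  A point \<open>x\<close> lies in the \<open>\<phi>\<close>-module domain of \<open>\<Phi>\<close> iff the defect vectors
  \<open>\<Phi>(xb)h - \<Phi>(x)\<phi>(b)h\<close> vanish for all \<open>b\<close> and \<open>h\<close>. Each defect vector is a difference of
  two vectors from the ranges of values of \<open>\<Phi>\<close>, and the \<open>\<phi>\<close>-map condition makes the inner
  product of any two such vectors a function of \<open>\<phi>\<close> alone:
  \<open>\<langle>\<Phi>(x)h, \<Phi>(y)k\<rangle> = \<langle>h, \<phi>(\<langle>x,y\<rangle>)k\<rangle>\<close> (lemma \<open>cinner_phi_map\<close>). So the norm of the defect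
  does not depend on \<open>\<Phi>\<close> (lemma \<open>norm_phi_map_diff\<close>), and the defects of two
  \<open>\<phi>\<close>-maps vanish simultaneously.

  Reading the \<open>\<phi>\<close>-map condition in terms of inner products presupposes that every bounded
  operator really has an adjoint, since \<open>adjoint_operator\<close> is a definite description. This is
  where completeness enters, through the Riesz representation theorem
  (lemma \<open>riesz_real_part\<close>), proved by minimising a quadratic functional.
\<close>

section \<open>Inner product identities\<close>

lemma cinner_add_left: "cinner (x + y) z = cinner x z + cinner y z"
  for x y z :: "'h::chilbert_space"
  by (metis cinner_add_right cinner_commute complex_cnj_add)

lemma cinner_scaleC_left: "cinner (c *\<^sub>C x) y = cnj c * cinner x y"
  for x y :: "'h::chilbert_space"
  by (metis cinner_commute cinner_scaleC_right complex_cnj_mult)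

lemma cinner_scaleR_right: "cinner x (r *\<^sub>R y) = complex_of_real r * cinner x y"
  for x y :: "'h::chilbert_space"
  by (simp add: scaleR_scaleC cinner_scaleC_right)

lemma cinner_minus_right: "cinner x (- y) = - cinner x y"
  for x y :: "'h::chilbert_space"
  using cinner_scaleR_right[of x "-1" y] by simp

lemma cinner_diff_left: "cinner (x - y) z = cinner x z - cinner y z"
  for x y z :: "'h::chilbert_space"
  using cinner_add_left[of "x - y" y z] by simp

lemma Re_cinner_commute: "Re (cinner x y) = Re (cinner y x)"
  for x y :: "'h::chilbert_space"
  by (subst cinner_commute) simp

lemma Re_cinner_self: "Re (cinner x x) = (norm x)\<^sup>2"
  for x :: "'h::chilbert_space"
  by (simp only: cinner_self Re_complex_of_real)

lemma norm_add_square: "(norm (x + y))\<^sup>2 = (norm x)\<^sup>2 + (norm y)\<^sup>2 + 2 * Re (cinner x y)"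
  for x y :: "'h::chilbert_space"
  unfolding Re_cinner_self[symmetric]
  by (simp add: cinner_add_left cinner_add_right Re_cinner_commute[of y x])

lemma norm_diff_square: "(norm (x - y))\<^sup>2 = (norm x)\<^sup>2 + (norm y)\<^sup>2 - 2 * Re (cinner x y)"
  for x y :: "'h::chilbert_space"
  using norm_add_square[of x "- y"] by (simp add: cinner_minus_right)

text \<open>
  The norm is a norm by hypothesis, so Cauchy-Schwarz for the real part can be read off from
  the triangle inequality.
\<close>

lemma Re_cinner_le: "Re (cinner x y) \<le> norm x * norm y"
  for x y :: "'h::chilbert_space"
proof -
  have "(norm (x + y))\<^sup>2 \<le> (norm x + norm y)\<^sup>2"
    by (simp add: norm_triangle_ineq power_mono)
  then show ?thesis
    by (simp add: norm_add_square power2_sum)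
qed

lemma cinner_left_eqI:
  fixes w w' :: "'h::chilbert_space"
  assumes "\<And>x. cinner w x = cinner w' x"
  shows "w = w'"
proof -
  have "cinner (w - w') (w - w') = 0"
    using assms by (simp add: cinner_diff_left)
  then show ?thesis
    by (simp add: cinner_self)
qed

section \<open>Riesz representation and adjoints\<close>

text \<open>
  The representing vector is the minimiser of \<open>J(x) = \<parallel>x\<parallel>\<^sup>2 - 2g(x)\<close>: where the
  derivative of \<open>J\<close> vanishes in every direction, \<open>Re \<langle>z,x\<rangle> = g(x)\<close>. By the parallelogram
  law, \<open>\<parallel>x - y\<parallel>\<^sup>2 = 2J(x) + 2J(y) - 4J((x+y)/2)\<close>, so minimising sequences are Cauchy.
\<close>

lemma riesz_real_part:
  fixes g :: "'h::chilbert_space \<Rightarrow> real"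
  assumes "bounded_linear g"
  shows "\<exists>z. \<forall>x. Re (cinner z x) = g x"
proof -
  interpret g: bounded_linear g by fact
  define J where "J x = (norm x)\<^sup>2 - 2 * g x" for x
  define m where "m = Inf (range J)"
  obtain C where C: "\<And>x. norm (g x) \<le> norm x * C"
    using g.bounded by blast
  have "J x \<ge> - C\<^sup>2" for x
  proof -
    have "g x \<le> norm x * C" using C[of x] by simp
    moreover have "0 \<le> (norm x - C)\<^sup>2" by simp
    ultimately show ?thesis by (simp add: J_def power2_diff)
  qed
  then have "bdd_below (range J)" by (auto intro!: bdd_belowI)
  then have m_le: "m \<le> J x" for x
    unfolding m_def by (rule cInf_lower[rotated]) simp
  have "\<exists>x. J x < m + 1 / real (Suc n)" for n
    using cInf_lessD[of "range J" "m + 1 / real (Suc n)"] by (auto simp: m_def)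
  then obtain X where X: "\<And>n. J (X n) < m + 1 / real (Suc n)" by metis
  have gap: "(norm (x - y))\<^sup>2 \<le> 2 * (J x - m) + 2 * (J y - m)" for x y
  proof -
    have "J ((1/2) *\<^sub>R (x + y)) = (norm (x + y))\<^sup>2 / 4 - g x - g y"
      unfolding J_def by (simp add: g.scaleR g.add power_divide add_divide_distrib)
    moreover have "(norm (x - y))\<^sup>2 = 2 * (norm x)\<^sup>2 + 2 * (norm y)\<^sup>2 - (norm (x + y))\<^sup>2"
      by (simp add: norm_add_square norm_diff_square)
    ultimately show ?thesis
      using m_le[of "(1/2) *\<^sub>R (x + y)"] by (simp add: J_def)
  qed
  have "Cauchy X"
  proof (rule CauchyI)
    fix e :: real assume "0 < e"
    then obtain N where N: "1 / real (Suc N) < e\<^sup>2 / 4"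
      using nat_approx_posE[of "e\<^sup>2 / 4"] by auto
    have tail: "J (X n) - m < e\<^sup>2 / 4" if "n \<ge> N" for n
    proof -
      have "1 / real (Suc n) \<le> 1 / real (Suc N)" using that by (simp add: frac_le)
      with X[of n] N show ?thesis by linarith
    qed
    have "norm (X k - X n) < e" if "k \<ge> N" "n \<ge> N" for k n
    proof -
      have "(norm (X k - X n))\<^sup>2 \<le> 2 * (J (X k) - m) + 2 * (J (X n) - m)"
        by (rule gap)
      also have "\<dots> < 2 * (e\<^sup>2 / 4) + 2 * (e\<^sup>2 / 4)"
        by (intro add_strict_mono mult_strict_left_mono tail that) simp_all
      also have "\<dots> = e\<^sup>2" by simp
      finally show ?thesis using \<open>0 < e\<close> by (simp add: power_less_imp_less_base)
    qed
    then show "\<exists>M. \<forall>k\<ge>M. \<forall>n\<ge>M. norm (X k - X n) < e" by blast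
  qed
  then obtain z where z: "X \<longlonglongrightarrow> z"
    using Cauchy_convergent convergent_def by blast
  have "(\<lambda>n. J (X n)) \<longlonglongrightarrow> J z"
    unfolding J_def by (intro tendsto_intros g.tendsto z)
  moreover have "(\<lambda>n. m + 1 / real (Suc n)) \<longlonglongrightarrow> m + 0"
    using LIMSEQ_inverse_real_of_nat by (intro tendsto_intros) (simp add: inverse_eq_divide)
  ultimately have Jz: "J z \<le> m"
    using LIMSEQ_le[of "\<lambda>n. J (X n)" "J z"] X by (fastforce intro: less_imp_le)
  have "Re (cinner z x) = g x" for x
  proof (rule ccontr)
    assume neq: "Re (cinner z x) \<noteq> g x"
    define b where "b = Re (cinner z x) - g x"
    define q where "q = (norm x)\<^sup>2 + 1"
    have q: "q > 0" by (simp add: q_def add_nonneg_pos)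
    \<comment> \<open>Up to the summand 1, which keeps \<open>q\<close> positive, this is the vertex of \<open>t \<mapsto> J(z + tx)\<close>.\<close>
    define t where "t = - b / q"
    have "J (z + t *\<^sub>R x) = J z + t\<^sup>2 * (norm x)\<^sup>2 + 2 * t * b"
      by (simp add: J_def b_def norm_add_square g.add g.scaleR cinner_scaleR_right
          power_mult_distrib algebra_simps)
    then have "0 \<le> t\<^sup>2 * (norm x)\<^sup>2 + 2 * t * b"
      using m_le[of "z + t *\<^sub>R x"] Jz by linarith
    also have "\<dots> = t\<^sup>2 * q - t\<^sup>2 + 2 * t * b"
      by (simp add: q_def algebra_simps)
    also have "\<dots> = - t\<^sup>2 - b\<^sup>2 / q"
      using q by (simp add: t_def power2_eq_square field_simps)
    also have "\<dots> < 0"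
    proof -
      have "b\<^sup>2 / q > 0" using neq q by (simp add: b_def)
      then show ?thesis using zero_le_power2[of t] by linarith
    qed
    finally show False by simp
  qed
  then show ?thesis by blast
qed

lemma bounded_operators_scaleC:
  "T \<in> bounded_operators \<Longrightarrow> blinfun_apply T (c *\<^sub>C x) = c *\<^sub>C blinfun_apply T x"
  by (simp add: bounded_operators_def)

lemma adjoint_vector_exists:
  fixes T :: "'h::chilbert_space \<Rightarrow>\<^sub>L 'k::chilbert_space"
  assumes T: "T \<in> bounded_operators"
  shows "\<exists>z. \<forall>x. cinner z x = cinner y (blinfun_apply T x)"
proof -
  define g where "g x = Re (cinner y (blinfun_apply T x))" for x
  have "bounded_linear g"
  proof (rule bounded_linear_intro[where K = "norm y * norm T"])
    show "norm (g x) \<le> norm x * (norm y * norm T)" for x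
    proof -
      have bound: "Re (cinner y (blinfun_apply T x')) \<le> norm x' * (norm y * norm T)" for x'
      proof -
        have "Re (cinner y (blinfun_apply T x')) \<le> norm y * norm (blinfun_apply T x')"
          by (rule Re_cinner_le)
        also have "\<dots> \<le> norm y * (norm T * norm x')"
          by (intro mult_left_mono norm_blinfun) simp
        finally show ?thesis by (simp add: mult_ac)
      qed
      show ?thesis
        using bound[of x] bound[of "- x"]
        by (simp add: g_def blinfun.minus_right cinner_minus_right abs_le_iff)
    qed
  qed (simp_all add: g_def blinfun.add_right blinfun.scaleR_right
      cinner_add_right cinner_scaleR_right)
  then obtain z where z: "\<And>x. Re (cinner z x) = Re (cinner y (blinfun_apply T x))"
    using riesz_real_part[of g] by (auto simp: g_def)
  \<comment> \<open>Complex linearity recovers imaginary parts, as \<open>Im w\<close> is the real part of \<open>- \<i> w\<close>.\<close>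
  have "Im (cinner z x) = Im (cinner y (blinfun_apply T x))" for x
    using z[of "(- \<i>) *\<^sub>C x"]
    by (simp add: bounded_operators_scaleC[OF T] cinner_scaleC_right)
  with z show ?thesis by (auto intro: complex_eqI)
qed

lemma cinner_adjoint_operator:
  fixes T :: "'h::chilbert_space \<Rightarrow>\<^sub>L 'k::chilbert_space"
  assumes T: "T \<in> bounded_operators"
  shows "cinner (blinfun_apply (adjoint_operator T) y) x = cinner y (blinfun_apply T x)"
proof -
  obtain s where s: "\<And>y x. cinner (s y) x = cinner y (blinfun_apply T x)"
    using adjoint_vector_exists[OF T] by metis
  have add: "s (y + y') = s y + s y'" for y y'
    by (rule cinner_left_eqI) (simp add: s cinner_add_left)
  have scale: "s (c *\<^sub>C y) = c *\<^sub>C s y" for c y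
    by (rule cinner_left_eqI) (simp add: s cinner_scaleC_left)
  have bound: "norm (s y) \<le> norm y * norm T" for y
  proof (cases "s y = 0")
    case False
    have "(norm (s y))\<^sup>2 = Re (cinner y (blinfun_apply T (s y)))"
      by (simp only: Re_cinner_self[symmetric] s)
    also have "\<dots> \<le> norm y * norm (blinfun_apply T (s y))"
      by (rule Re_cinner_le)
    also have "\<dots> \<le> norm y * (norm T * norm (s y))"
      by (intro mult_left_mono norm_blinfun) simp
    finally have "norm (s y) * norm (s y) \<le> (norm y * norm T) * norm (s y)"
      by (simp add: power2_eq_square mult_ac)
    then show ?thesis using False by simp
  qed simp
  have "bounded_linear s"
    by (rule bounded_linear_intro[OF add _ bound]) (simp add: scaleR_scaleC scale)
  then have apply_s: "blinfun_apply (Blinfun s) = s"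
    by (rule bounded_linear_Blinfun_apply)
  let ?adj = "\<lambda>S. S \<in> bounded_operators \<and>
     (\<forall>x y. cinner (blinfun_apply S y) x = cinner y (blinfun_apply T x))"
  have "?adj (Blinfun s)"
    by (simp add: bounded_operators_def apply_s scale s)
  moreover have "S = Blinfun s" if "?adj S" for S
  proof (rule blinfun_eqI)
    show "blinfun_apply S y = blinfun_apply (Blinfun s) y" for y
      by (rule cinner_left_eqI) (simp add: apply_s s that)
  qed
  ultimately have "?adj (adjoint_operator T)"
    unfolding adjoint_operator_def by (rule theI)
  then show ?thesis by blast
qed

section \<open>Independence of the module domain\<close>

lemma cinner_phi_map:
  fixes \<Phi> :: "'x \<Rightarrow> 'h::chilbert_space \<Rightarrow>\<^sub>L 'k::chilbert_space"
  assumes "phi_map ip \<phi> \<Phi>"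
  shows "cinner (blinfun_apply (\<Phi> x) h) (blinfun_apply (\<Phi> y) k)
    = cinner h (blinfun_apply (\<phi> (ip x y)) k)"
proof -
  have \<Phi>x: "\<Phi> x \<in> bounded_operators"
    and comp: "adjoint_operator (\<Phi> x) o\<^sub>L \<Phi> y = \<phi> (ip x y)"
    using assms by (auto simp: phi_map_def)
  have "cinner (blinfun_apply (\<phi> (ip x y)) k) h
      = cinner (blinfun_apply (\<Phi> y) k) (blinfun_apply (\<Phi> x) h)"
    using cinner_adjoint_operator[OF \<Phi>x] by (simp add: comp[symmetric])
  then show ?thesis by (metis cinner_commute)
qed

text \<open>
  The right-hand side does not mention \<open>\<Phi>\<close>, so two \<open>\<phi>\<close>-maps satisfy the same relations
  \<open>\<Phi>(x)h = \<Phi>(y)k\<close>.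
\<close>

lemma norm_phi_map_diff:
  fixes \<Phi> :: "'x \<Rightarrow> 'h::chilbert_space \<Rightarrow>\<^sub>L 'k::chilbert_space"
  assumes "phi_map ip \<phi> \<Phi>"
  shows "(norm (blinfun_apply (\<Phi> x) h - blinfun_apply (\<Phi> y) k))\<^sup>2
    = Re (cinner h (blinfun_apply (\<phi> (ip x x)) h))
      + Re (cinner k (blinfun_apply (\<phi> (ip y y)) k))
      - 2 * Re (cinner h (blinfun_apply (\<phi> (ip x y)) k))"
  unfolding norm_diff_square
  unfolding Re_cinner_self[symmetric] cinner_phi_map[OF assms] by (rule refl)

lemma phi_map_eq_iff:
  fixes \<Phi>\<^sub>1 :: "'x \<Rightarrow> 'h::chilbert_space \<Rightarrow>\<^sub>L 'k1::chilbert_space"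
    and \<Phi>\<^sub>2 :: "'x \<Rightarrow> 'h \<Rightarrow>\<^sub>L 'k2::chilbert_space"
  assumes "phi_map ip \<phi> \<Phi>\<^sub>1" and "phi_map ip \<phi> \<Phi>\<^sub>2"
  shows "blinfun_apply (\<Phi>\<^sub>1 x) h = blinfun_apply (\<Phi>\<^sub>1 y) k
    \<longleftrightarrow> blinfun_apply (\<Phi>\<^sub>2 x) h = blinfun_apply (\<Phi>\<^sub>2 y) k"
proof -
  have "(norm (blinfun_apply (\<Phi>\<^sub>1 x) h - blinfun_apply (\<Phi>\<^sub>1 y) k))\<^sup>2
      = (norm (blinfun_apply (\<Phi>\<^sub>2 x) h - blinfun_apply (\<Phi>\<^sub>2 y) k))\<^sup>2"
    by (simp only: norm_phi_map_diff[OF assms(1)] norm_phi_map_diff[OF assms(2)])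
  then have "norm (blinfun_apply (\<Phi>\<^sub>1 x) h - blinfun_apply (\<Phi>\<^sub>1 y) k)
      = norm (blinfun_apply (\<Phi>\<^sub>2 x) h - blinfun_apply (\<Phi>\<^sub>2 y) k)"
    by simp
  then show ?thesis by (metis norm_eq_zero right_minus_eq)
qed

lemma module_domain_iff:
  "x \<in> module_domain act \<phi> \<Phi> \<longleftrightarrow>
    (\<forall>b h. blinfun_apply (\<Phi> (act x b)) h = blinfun_apply (\<Phi> x) (blinfun_apply (\<phi> b) h))"
  by (auto simp: module_domain_def intro!: blinfun_eqI dest: arg_cong[where f = blinfun_apply])

theorem theorem3p9:
  fixes act :: "'x::{complex_normed_vector, banach} \<Rightarrow> 'a::cstar_algebra \<Rightarrow> 'x"
    and ip :: "'x \<Rightarrow> 'x \<Rightarrow> 'a"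
    and \<phi> :: "'a \<Rightarrow> 'h::chilbert_space \<Rightarrow>\<^sub>L 'h"
    and \<Phi>\<^sub>1 :: "'x \<Rightarrow> 'h \<Rightarrow>\<^sub>L 'k1::chilbert_space"
    and \<Phi>\<^sub>2 :: "'x \<Rightarrow> 'h \<Rightarrow>\<^sub>L 'k2::chilbert_space"
  assumes "hilbert_module act ip"
    and "completely_positive_linear \<phi>"
    and "phi_map ip \<phi> \<Phi>\<^sub>1"
    and "phi_map ip \<phi> \<Phi>\<^sub>2"
  shows "module_domain act \<phi> \<Phi>\<^sub>1 = module_domain act \<phi> \<Phi>\<^sub>2"
  by (rule set_eqI) (simp only: module_domain_iff phi_map_eq_iff[OF assms(3,4)])

end
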